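(* Let $n$ be a nonnegative integer with $n\equiv 2$ or $n\equiv 3\pmod 4$, and let $F$ be any function from the set of $n$-shapes to $\mathbb{C}$ such that for every $n$-shape $\lambda$, $F(\lambda)=F(\lambda')$, and $I_\lambda=0$ implies $F(\lambda)=0$. Then $$\sum_{\lambda\vdash n}(-1)^{v(\lambda)}F(\lambda)=0.$$
   Context: A shape $\lambda$ is the Ferrers diagram of an integer partition; an $n$-shape ($\lambda\vdash n$) has $n$ squares; $\lambda'$ denotes the conjugate (transposed) shape. A standard Young tableau (SYT) on an $n$-shape is a filling with $1,\ldots,n$, each once, increasing along rows and down columns. The sign $\mathrm{sgn}(T)$ of a tableau is the sign of the word obtained by reading its entries row by row, left to right, top to bottom; the sign of a word of distinct integers is $(-1)^{\#\text{inversions}}$. $I_\lambda=\sum_{T\in\mathrm{SYT}(\lambda)}\mathrm{sgn}(T)$. $v(\lambda)$ is the maximal number of disjoint vertical dominoes ($2\times1$ rectangles) that fit in $\lambda$. *)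

theory Defs
  imports Complex_Main "HOL-Library.FuncSet"
begin

text \<open>Cells are pairs (row, column), both counted from 0, with row 0 on top.\<close>

type_synonym cell = "nat \<times> nat"

definition partitions :: "nat \<Rightarrow> nat list set" where
  "partitions n = {p. sorted_wrt (\<ge>) p \<and> 0 \<notin> set p \<and> sum_list p = n}"

definition ferrers :: "nat list \<Rightarrow> cell set" where
  "ferrers p = {(i, j). i < length p \<and> j < p ! i}"

definition shapes :: "nat \<Rightarrow> cell set set" where
  "shapes n = ferrers ` partitions n"

definition conjugate :: "cell set \<Rightarrow> cell set" where
  "conjugate L = prod.swap ` L"

text \<open>Tableaux are required to be extensional, so that distinct functions are distinct fillings.\<close>

definition SYT :: "cell set \<Rightarrow> (cell \<Rightarrow> nat) set" where
  "SYT L = {T \<in> extensional L. bij_betw T L {1..card L} \<and>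
     (\<forall>i j k. (i, j) \<in> L \<and> (i, k) \<in> L \<and> j < k \<longrightarrow> T (i, j) < T (i, k)) \<and>
     (\<forall>i j k. (i, k) \<in> L \<and> (j, k) \<in> L \<and> i < j \<longrightarrow> T (i, k) < T (j, k))}"

definition inversions :: "nat list \<Rightarrow> (nat \<times> nat) set" where
  "inversions w = {(a, b). a < b \<and> b < length w \<and> w ! a > w ! b}"

definition word_sign :: "nat list \<Rightarrow> int" where
  "word_sign w = (-1) ^ card (inversions w)"

definition reading_word :: "cell set \<Rightarrow> (cell \<Rightarrow> nat) \<Rightarrow> nat list" where
  "reading_word L T =
     concat (map (\<lambda>i. map (\<lambda>j. T (i, j)) (sorted_list_of_set {j. (i, j) \<in> L}))
                 (sorted_list_of_set (fst ` L)))"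

definition tableau_sign :: "cell set \<Rightarrow> (cell \<Rightarrow> nat) \<Rightarrow> int" where
  "tableau_sign L T = word_sign (reading_word L T)"

definition imbalance :: "cell set \<Rightarrow> int" where
  "imbalance L = (\<Sum>T\<in>SYT L. tableau_sign L T)"

definition vertical_domino :: "cell set \<Rightarrow> bool" where
  "vertical_domino d \<longleftrightarrow> (\<exists>i j. d = {(i, j), (Suc i, j)})"

definition vertical_packings :: "cell set \<Rightarrow> cell set set set" where
  "vertical_packings L = {D. (\<forall>d\<in>D. vertical_domino d \<and> d \<subseteq> L) \<and> pairwise disjnt D}"

definition vdom :: "cell set \<Rightarrow> nat" where
  "vdom L = Max (card ` vertical_packings L)"

text \<open>The sums over shapes and over tableaux, and the maximum in the definition of \<open>vdom\<close>, range
  over finite sets.\<close>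

lemma finite_ferrers: "finite (ferrers p)"
proof -
  have "ferrers p = (SIGMA i:{..<length p}. {..<p ! i})"
    by (auto simp: ferrers_def)
  then show ?thesis by simp
qed

lemma finite_partitions: "finite (partitions n)"
proof -
  have len: "length p \<le> sum_list p" if "0 \<notin> set p" for p :: "nat list"
    using that by (induction p) auto
  have "partitions n \<subseteq> {p. set p \<subseteq> {..n} \<and> length p \<le> n}"
    using len by (auto simp: partitions_def intro: member_le_sum_list)
  moreover have "finite {p. set p \<subseteq> {..n} \<and> length p \<le> n}"
    by (rule finite_lists_length_le) simp
  ultimately show ?thesis by (rule finite_subset)
qed

lemma finite_shapes: "finite (shapes n)"
  by (simp add: shapes_def finite_partitions)

lemma finite_shape: "L \<in> shapes n \<Longrightarrow> finite L"
  by (auto simp: shapes_def finite_ferrers)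

lemma finite_SYT:
  assumes "finite L"
  shows "finite (SYT L)"
proof -
  have "SYT L \<subseteq> L \<rightarrow>\<^sub>E {1..card L}"
    by (auto simp: SYT_def PiE_def bij_betw_def)
  moreover have "finite (L \<rightarrow>\<^sub>E {1..card L})"
    using assms by (intro finite_PiE) auto
  ultimately show ?thesis by (rule finite_subset)
qed

lemma finite_vertical_packings:
  assumes "finite L"
  shows "finite (vertical_packings L)" "{} \<in> vertical_packings L"
proof -
  have "vertical_packings L \<subseteq> Pow (Pow L)"
    by (auto simp: vertical_packings_def)
  then show "finite (vertical_packings L)"
    using assms by (meson finite_Pow_iff finite_subset)
  show "{} \<in> vertical_packings L"
    by (simp add: vertical_packings_def)
qed

end

theory Submission
  imports Defs "HOL-Combinatorics.Transposition"
begin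

text \<open>Since \<open>vdom L\<close> counts the cells of \<open>L\<close> in odd rows (rows counted from 0) and
  \<open>vdom (conjugate L)\<close> those in odd columns, their sum has the parity of the number of cells \<open>(i, j)\<close>
  with \<open>i + j\<close> odd, the black cells of a checkerboard. Pair the entries as \<open>{n - 1, n}\<close>,
  \<open>{n - 3, n - 2}\<close>, and so on, leaving out 1 if \<open>n\<close> is odd. Swapping the first pair not lying in a
  common row or column is a sign-reversing involution on tableaux, so \<open>imbalance L \<noteq> 0\<close> forces a
  tableau in which every pair fills a domino. Each domino has exactly one black cell, and the cell
  \<open>(0, 0)\<close> holding 1 is white, so there are \<open>n div 2\<close> black cells. This is odd, hence the terms of
  \<open>L\<close> and \<open>conjugate L\<close> cancel.\<close>

subsection \<open>Shapes as finite order ideals\<close>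

text \<open>Unlike a list of row lengths, this condition treats rows and columns alike, so
  conjugation preserves it trivially.\<close>

definition down_closed :: "cell set \<Rightarrow> bool" where
  "down_closed L \<longleftrightarrow> (\<forall>i j i' j'. (i, j) \<in> L \<longrightarrow> i' \<le> i \<longrightarrow> j' \<le> j \<longrightarrow> (i', j') \<in> L)"

lemma down_closedD: "down_closed L \<Longrightarrow> (i, j) \<in> L \<Longrightarrow> i' \<le> i \<Longrightarrow> j' \<le> j \<Longrightarrow> (i', j') \<in> L"
  unfolding down_closed_def by blast

lemma card_ferrers: "card (ferrers p) = sum_list p"
proof -
  have "ferrers p = (SIGMA i:{..<length p}. {..<p ! i})"
    by (auto simp: ferrers_def)
  then show ?thesis
    by (simp add: sum_list_sum_nth atLeast0LessThan)
qed

lemma down_closed_ferrers: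
  assumes "sorted_wrt (\<ge>) p"
  shows "down_closed (ferrers p)"
  unfolding down_closed_def
proof (intro allI impI)
  fix i j i' j'
  assume "(i, j) \<in> ferrers p" "i' \<le> i" "j' \<le> j"
  moreover from this have "p ! i \<le> p ! i'"
    using sorted_wrt_nth_less[OF assms, of i' i] by (cases "i' = i") (auto simp: ferrers_def)
  ultimately show "(i', j') \<in> ferrers p"
    by (auto simp: ferrers_def)
qed

lemma finite_down_set_nat:
  fixes A :: "nat set"
  assumes "finite A" "\<And>x y. x \<in> A \<Longrightarrow> y \<le> x \<Longrightarrow> y \<in> A"
  shows "A = {..<card A}"
proof (cases "A = {}")
  case False
  then have "A = {..Max A}"
    using assms by (auto intro: Max_ge dest: Max_in)
  then show ?thesis
    by (metis card_atMost lessThan_Suc_atMost)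
qed simp

text \<open>Every row, and the set of nonempty rows, is a finite initial segment of the naturals.
  The row lengths thus determine the set and form the partition.\<close>

lemma down_closed_in_shapes:
  assumes "finite L" "down_closed L"
  shows "L \<in> shapes (card L)"
proof -
  define r where "r i = card {j. (i, j) \<in> L}" for i
  define l where "l = card (fst ` L)"
  define p where "p = map r [0..<l]"
  have fin: "finite {j. (i, j) \<in> L}" for i
    by (rule finite_subset[of _ "snd ` L"]) (use assms(1) in force)+
  have row: "(i, j) \<in> L \<longleftrightarrow> j < r i" for i j
  proof -
    have "{j. (i, j) \<in> L} = {..<r i}"
      unfolding r_def using fin by (rule finite_down_set_nat) (auto intro: down_closedD[OF assms(2)])
    then show ?thesis by blast
  qed
  \<comment> \<open>A row is nonempty iff it meets column 0, so the row indices can be read off the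
    first column.\<close>
  have fst_L: "i \<in> fst ` L \<longleftrightarrow> (i, 0) \<in> L" for i
    by (auto simp: image_iff Bex_def row)
  have "fst ` L = {..<l}"
    unfolding l_def
  proof (rule finite_down_set_nat)
    show "y \<in> fst ` L" if "x \<in> fst ` L" "y \<le> x" for x y
      using that down_closedD[OF assms(2), of x 0 y 0] by (simp add: fst_L)
  qed (use assms(1) in simp)
  then have rows: "i < l \<longleftrightarrow> 0 < r i" for i
    using fst_L[of i] by (simp add: row)
  have "L = ferrers p"
    unfolding ferrers_def p_def using row rows by fastforce
  moreover have "r i' \<le> r i" if "i \<le> i'" for i i'
    unfolding r_def using fin that
    by (intro card_mono) (auto intro: down_closedD[OF assms(2)])
  then have "sorted_wrt (\<ge>) p"
    by (auto simp: p_def sorted_wrt_iff_nth_less)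
  moreover have "0 \<notin> set p"
  proof
    assume "0 \<in> set p"
    then obtain i where "i < l" "r i = 0"
      by (auto simp: p_def)
    then show False
      using rows[of i] by simp
  qed
  ultimately show ?thesis
    using card_ferrers[of p] by (auto simp: shapes_def partitions_def)
qed

lemma shapes_iff: "L \<in> shapes n \<longleftrightarrow> finite L \<and> down_closed L \<and> card L = n"
proof
  assume "L \<in> shapes n"
  then show "finite L \<and> down_closed L \<and> card L = n"
    by (auto simp: shapes_def partitions_def finite_ferrers card_ferrers down_closed_ferrers)
qed (use down_closed_in_shapes in blast)

lemma conjugate_conjugate [simp]: "conjugate (conjugate L) = L"
  by (force simp: conjugate_def)

lemma mem_conjugate [simp]: "(i, j) \<in> conjugate L \<longleftrightarrow> (j, i) \<in> L"
  by (force simp: conjugate_def)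

lemma conjugate_in_shapes:
  assumes "L \<in> shapes n"
  shows "conjugate L \<in> shapes n"
proof -
  have "card (conjugate L) = card L"
    unfolding conjugate_def by (rule card_image) simp
  moreover have "finite (conjugate L)" if "finite L"
    using that by (simp add: conjugate_def)
  ultimately show ?thesis
    using assms by (auto simp: shapes_iff down_closed_def)
qed

lemma bij_betw_conjugate_shapes: "bij_betw conjugate (shapes n) (shapes n)"
  by (rule bij_betw_byWitness[where f' = conjugate]) (auto intro: conjugate_in_shapes)

subsection \<open>Vertical dominoes\<close>

text \<open>Each vertical domino covers exactly one cell of an odd row, which bounds every packing.
  Joining each such cell to the one above it attains the bound.\<close>

lemma vdom_eq_card_odd_rows:
  assumes "finite L" "down_closed L"
  shows "vdom L = card {c \<in> L. odd (fst c)}"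
proof -
  define R where "R = {c \<in> L. odd (fst c)}"
  define g :: "cell \<Rightarrow> cell set" where "g c = {(fst c - 1, snd c), c}" for c
  have finR: "finite R"
    using assms by (simp add: R_def)
  have g_disj: "disjnt (g c) (g d)" if "c \<in> R" "d \<in> R" "c \<noteq> d" for c d
  proof -
    have "odd (fst c)" "odd (fst d)"
      using that by (simp_all add: R_def)
    \<comment> \<open>Truncated subtraction is harmless, as odd row indices are positive. The first
      two inequalities hold by parity.\<close>
    then have "fst c - 1 \<noteq> fst d" "fst d - 1 \<noteq> fst c" "fst c - 1 = fst d - 1 \<longleftrightarrow> fst c = fst d"
      by presburger+
    then show ?thesis
      using that(3) by (auto simp: g_def disjnt_def prod_eq_iff)
  qed
  have "inj_on g R"
  proof (rule inj_onI, rule ccontr)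
    fix c d assume "c \<in> R" "d \<in> R" "g c = g d" "c \<noteq> d"
    then show False
      using g_disj[of c d] by (simp add: g_def)
  qed
  then have "card (g ` R) = card R"
    by (rule card_image)
  moreover have "g ` R \<in> vertical_packings L"
  proof -
    have "vertical_domino (g c) \<and> g c \<subseteq> L" if "c \<in> R" for c
    proof -
      obtain i j where c: "c = (Suc i, j)" "(Suc i, j) \<in> L"
        using \<open>c \<in> R\<close> by (cases c) (auto simp: R_def elim!: oddE)
      then show ?thesis
        using down_closedD[OF assms(2), of "Suc i" j i j]
        by (auto simp: g_def vertical_domino_def)
    qed
    moreover have "pairwise disjnt (g ` R)"
      using g_disj by (auto simp: pairwise_def)
    ultimately show ?thesis
      by (auto simp: vertical_packings_def)
  qed
  moreover have "card D \<le> card R" if D: "D \<in> vertical_packings L" for D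
  proof -
    have "\<exists>c. c \<in> d \<and> c \<in> R" if "d \<in> D" for d
    proof -
      obtain i j where "d = {(i, j), (Suc i, j)}" "d \<subseteq> L"
        using D \<open>d \<in> D\<close> by (auto simp: vertical_packings_def vertical_domino_def)
      then show ?thesis
        by (intro exI[of _ "if odd i then (i, j) else (Suc i, j)"]) (auto simp: R_def)
    qed
    then obtain f where f: "\<And>d. d \<in> D \<Longrightarrow> f d \<in> d \<and> f d \<in> R"
      by metis
    \<comment> \<open>Disjoint dominoes cannot share their chosen odd-row cell.\<close>
    moreover have "inj_on f D"
    proof (rule inj_onI, rule ccontr)
      fix d e assume "d \<in> D" "e \<in> D" "f d = f e" "d \<noteq> e"
      moreover from this have "disjnt d e"
        using D by (auto simp: vertical_packings_def intro: pairwiseD)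
      ultimately show False
        using f[of d] f[of e] unfolding disjnt_iff by metis
    qed
    ultimately show ?thesis
      using finR by (intro card_inj_on_le[of f]) auto
  qed
  ultimately show ?thesis
    unfolding vdom_def R_def[symmetric] using finite_vertical_packings[OF assms(1)]
    by (intro Max_eqI) (auto intro: image_eqI[of _ card "g ` R"])
qed

lemma vdom_conjugate:
  assumes "finite L" "down_closed L"
  shows "vdom (conjugate L) = card {c \<in> L. odd (snd c)}"
proof -
  have "finite (conjugate L)" "down_closed (conjugate L)"
    using assms by (auto simp: conjugate_def[of L] down_closed_def)
  then have "vdom (conjugate L) = card {c \<in> conjugate L. odd (fst c)}"
    by (rule vdom_eq_card_odd_rows)
  also have "{c \<in> conjugate L. odd (fst c)} = prod.swap ` {c \<in> L. odd (snd c)}"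
    by (force simp: conjugate_def)
  also have "card \<dots> = card {c \<in> L. odd (snd c)}"
    by (rule card_image) simp
  finally show ?thesis .
qed

lemma even_vdom_add_vdom_conjugate:
  assumes "finite L" "down_closed L"
  shows "even (vdom L + vdom (conjugate L)) \<longleftrightarrow> even (card {c \<in> L. odd (fst c + snd c)})"
proof -
  have card_eq: "card {c \<in> L. P c} = (\<Sum>c\<in>L. of_bool (P c))" for P
    using assms(1) by (simp add: sum.If_cases Int_def of_bool_def)
  show ?thesis
    unfolding vdom_eq_card_odd_rows[OF assms] vdom_conjugate[OF assms] card_eq sum.distrib[symmetric]
    \<comment> \<open>Modulo 2 only the cells with an odd summand count, that is, those with exactly
      one odd coordinate.\<close>
    by (simp add: even_sum_iff assms(1)) (rule arg_cong[of _ _ "\<lambda>A. even (card A)"], auto)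
qed

subsection \<open>The sign-reversing involution\<close>

text \<open>\<open>m\<close> and \<open>Suc m\<close> compare alike with every other value, so only
  the relative order of these two letters changes.\<close>

lemma inversions_transpose_adjacent:
  assumes "distinct w" "p < q" "q < length w" "w ! p = m" "w ! q = Suc m"
  shows "inversions (map (transpose m (Suc m)) w) = insert (p, q) (inversions w)"
proof -
  have idx: "w ! x = m \<longleftrightarrow> x = p" "w ! x = Suc m \<longleftrightarrow> x = q" if "x < length w" for x
    using nth_eq_iff_index_eq[OF assms(1) that, of p] nth_eq_iff_index_eq[OF assms(1) that, of q] assms
    by auto
  have "(transpose m (Suc m) (w ! a) > transpose m (Suc m) (w ! b)) \<longleftrightarrow>
      (a, b) = (p, q) \<or> w ! a > w ! b" if "a < b" "b < length w" for a b
  proof -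
    have "w ! a = m \<longleftrightarrow> a = p" "w ! a = Suc m \<longleftrightarrow> a = q"
      "w ! b = m \<longleftrightarrow> b = p" "w ! b = Suc m \<longleftrightarrow> b = q" "w ! a \<noteq> w ! b"
      using idx[of a] idx[of b] that nth_eq_iff_index_eq[OF assms(1), of a b] by auto
    then show ?thesis
      using that assms by (auto simp: transpose_def)
  qed
  then show ?thesis
    using assms by (auto simp: inversions_def)
qed

lemma word_sign_transpose_adjacent:
  assumes "distinct w" "m \<in> set w" "Suc m \<in> set w"
  shows "word_sign (map (transpose m (Suc m)) w) = - word_sign w"
proof -
  have less: "word_sign (map (transpose m (Suc m)) w) = - word_sign w"
    if "distinct w" "p < q" "q < length w" "w ! p = m" "w ! q = Suc m" for w p q
  proof -
    have "finite (inversions w)"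
      by (rule finite_subset[of _ "{..<length w} \<times> {..<length w}"]) (auto simp: inversions_def)
    moreover have "(p, q) \<notin> inversions w"
      using that by (simp add: inversions_def)
    ultimately show ?thesis
      unfolding word_sign_def inversions_transpose_adjacent[OF that] by simp
  qed
  obtain p q where pq: "p < length w" "q < length w" "w ! p = m" "w ! q = Suc m"
    using assms(2,3) by (auto simp: in_set_conv_nth)
  then consider "p < q" | "q < p"
    by (metis n_not_Suc_n nat_neq_iff)
  then show ?thesis
  proof cases
    case 1
    then show ?thesis
      using less[of w p q] pq assms(1) by blast
  next
    case 2
    \<comment> \<open>If \<open>Suc m\<close> comes first, the swapped word has the letters in the
      order that \<open>less\<close> requires.\<close>
    define w' where "w' = map (transpose m (Suc m)) w"
    have "distinct w'" "map (transpose m (Suc m)) w' = w"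
      using assms(1) by (simp_all add: w'_def distinct_map)
    moreover have "w' ! q = m" "w' ! p = Suc m" "p < length w'"
      using pq by (simp_all add: w'_def)
    ultimately show ?thesis
      using less[of w' q p] 2 by (simp add: w'_def)
  qed
qed

text \<open>The order of the cells does not depend on the tableau, so a change of entries acts
  letterwise on the reading word.\<close>

definition cells_row_order :: "cell set \<Rightarrow> cell list" where
  "cells_row_order L =
     concat (map (\<lambda>i. map (Pair i) (sorted_list_of_set {j. (i, j) \<in> L}))
                 (sorted_list_of_set (fst ` L)))"

lemma reading_word_conv_map: "reading_word L T = map T (cells_row_order L)"
  by (simp add: reading_word_def cells_row_order_def map_concat comp_def)

lemma cells_row_order:
  assumes "finite L"
  shows "set (cells_row_order L) = L" "distinct (cells_row_order L)"
proof -
  have fin: "finite {j. (i, j) \<in> L}" for i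
    by (rule finite_subset[of _ "snd ` L"]) (use assms in force)+
  show "set (cells_row_order L) = L"
    using assms fin by (force simp: cells_row_order_def)
  have "distinct (concat (map (\<lambda>i. map (Pair i) (sorted_list_of_set {j. (i, j) \<in> L})) xs))"
    if "distinct xs" for xs
    using that fin by (induction xs) (auto simp: distinct_map inj_on_def)
  then show "distinct (cells_row_order L)"
    by (simp add: cells_row_order_def)
qed

text \<open>The restriction keeps the result extensional, as \<open>SYT\<close> demands.\<close>

definition swap_entries :: "cell set \<Rightarrow> nat \<Rightarrow> (cell \<Rightarrow> nat) \<Rightarrow> cell \<Rightarrow> nat" where
  "swap_entries L m T = restrict (transpose m (Suc m) \<circ> T) L"

lemma swap_entries_swap_entries:
  assumes "T \<in> SYT L"
  shows "swap_entries L m (swap_entries L m T) = T"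
proof
  fix c show "swap_entries L m (swap_entries L m T) c = T c"
    using extensional_arb[of T L c] assms by (simp add: swap_entries_def SYT_def)
qed

lemma tableau_sign_swap_entries:
  assumes "finite L" "T \<in> SYT L" "1 \<le> m" "m < card L"
  shows "tableau_sign L (swap_entries L m T) = - tableau_sign L T"
proof -
  have T: "inj_on T L" "T ` L = {1..card L}"
    using assms(2) by (auto simp: SYT_def bij_betw_def)
  have "reading_word L (swap_entries L m T) = map (transpose m (Suc m)) (reading_word L T)"
    using cells_row_order(1)[OF assms(1)]
    by (auto simp: reading_word_conv_map swap_entries_def)
  moreover have "distinct (reading_word L T)" "set (reading_word L T) = {1..card L}"
    using T cells_row_order[OF assms(1)] by (auto simp: reading_word_conv_map distinct_map)
  ultimately show ?thesis
    using assms(3,4) by (simp add: tableau_sign_def word_sign_transpose_adjacent)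
qed

text \<open>For a standard tableau this is the exact obstruction to swapping \<open>m\<close> and
  \<open>Suc m\<close>.\<close>

definition aligned :: "cell set \<Rightarrow> (cell \<Rightarrow> nat) \<Rightarrow> nat \<Rightarrow> bool" where
  "aligned L T m \<longleftrightarrow> (\<exists>c\<in>L. \<exists>d\<in>L. T c = m \<and> T d = Suc m \<and> (fst c = fst d \<or> snd c = snd d))"

lemma swap_entries_in_SYT:
  assumes "T \<in> SYT L" "1 \<le> m" "m < card L" "\<not> aligned L T m"
  shows "swap_entries L m T \<in> SYT L"
proof -
  let ?s = "transpose m (Suc m)"
  have mono: "?s (T c) < ?s (T d)"
    if "T c < T d" "c \<in> L" "d \<in> L" "fst c = fst d \<or> snd c = snd d" for c d
  proof -
    have "\<not> (T c = m \<and> T d = Suc m)"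
      using that assms(4) by (auto simp: aligned_def)
    then show ?thesis
      using that(1) by (auto simp: transpose_def)
  qed
  have "bij_betw ?s {1..card L} {1..card L}"
    by (rule bij_betw_byWitness[where f' = ?s]) (use assms in \<open>auto simp: transpose_def\<close>)
  then have "bij_betw (?s \<circ> T) L {1..card L}"
    using assms(1) by (auto simp: SYT_def intro: bij_betw_trans)
  then have "bij_betw (swap_entries L m T) L {1..card L}"
    by (rule bij_betw_cong[THEN iffD1, rotated]) (simp add: swap_entries_def)
  then show ?thesis
    using assms(1) mono by (auto simp: SYT_def swap_entries_def)
qed

text \<open>This keeps the choice of the pair to swap stable. For \<open>k = m\<close> the two cells
  just exchange roles; otherwise the parity conditions make the pairs starting at \<open>k\<close>
  and \<open>m\<close> disjoint.\<close>

lemma aligned_swap_entries: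
  assumes "odd (card L - m)" "odd (card L - k)" "m < card L" "k < card L"
  shows "aligned L (swap_entries L m T) k \<longleftrightarrow> aligned L T k"
proof (cases "k = m")
  case True
  have "transpose m (Suc m) x = m \<longleftrightarrow> x = Suc m" "transpose m (Suc m) x = Suc m \<longleftrightarrow> x = m" for x
    by (auto simp: transpose_def)
  then show ?thesis
    unfolding True aligned_def swap_entries_def by (simp cong: bex_cong) metis
next
  case False
  have "k \<noteq> Suc m" "m \<noteq> Suc k"
    using assms by (auto simp: Suc_diff_Suc[symmetric])
  then have "transpose m (Suc m) x = k \<longleftrightarrow> x = k" "transpose m (Suc m) x = Suc k \<longleftrightarrow> x = Suc k" for x
    using False by (auto simp: transpose_def)
  then show ?thesis
    unfolding aligned_def swap_entries_def by auto
qed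

lemma imbalance_eq_0:
  assumes "finite L"
    and bad: "\<And>T. T \<in> SYT L \<Longrightarrow> \<exists>m. 1 \<le> m \<and> m < card L \<and> odd (card L - m) \<and> \<not> aligned L T m"
  shows "imbalance L = 0"
proof -
  \<comment> \<open>The smaller members of the pairs, which are formed from the largest entry
    downwards.\<close>
  define M where "M = {m. 1 \<le> m \<and> m < card L \<and> odd (card L - m)}"
  define f where "f T = (LEAST m. m \<in> M \<and> \<not> aligned L T m)" for T
  define g where "g T = swap_entries L (f T) T" for T
  have f: "f T \<in> M \<and> \<not> aligned L T (f T)" if "T \<in> SYT L" for T
    unfolding f_def by (rule LeastI_ex) (use bad[OF that] in \<open>auto simp: M_def\<close>)
  have g_SYT: "g T \<in> SYT L" if "T \<in> SYT L" for T
    using f[OF that] that by (auto simp: g_def M_def intro: swap_entries_in_SYT)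
  \<comment> \<open>The swap leaves the set of non-aligned indices in \<open>M\<close> unchanged,
    hence also its least element; this makes \<open>g\<close> an involution.\<close>
  have f_g: "f (g T) = f T" if "T \<in> SYT L" for T
  proof -
    have "m \<in> M \<and> \<not> aligned L (g T) m \<longleftrightarrow> m \<in> M \<and> \<not> aligned L T m" for m
      using f[OF that] by (auto simp: g_def M_def aligned_swap_entries)
    then show ?thesis
      by (simp add: f_def)
  qed
  have "g (g T) = T" if "T \<in> SYT L" for T
    using f_g[OF that] swap_entries_swap_entries[OF that] by (simp add: g_def)
  then have "bij_betw g (SYT L) (SYT L)"
    using g_SYT by (intro bij_betw_byWitness[where f' = g]) auto
  then have "imbalance L = (\<Sum>T\<in>SYT L. tableau_sign L (g T))"
    unfolding imbalance_def by (rule sum.reindex_bij_betw[symmetric])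
  also have "\<dots> = (\<Sum>T\<in>SYT L. - tableau_sign L T)"
    using f by (intro sum.cong) (auto simp: g_def M_def intro: tableau_sign_swap_entries assms(1))
  also have "\<dots> = - imbalance L"
    by (simp add: imbalance_def sum_negf)
  finally show ?thesis by simp
qed

subsection \<open>Counting black cells\<close>

text \<open>A cell strictly between \<open>c\<close> and \<open>d\<close> would lie in
  \<open>L\<close> and carry an entry strictly between two consecutive integers. So the cells are
  adjacent and have opposite colours.\<close>

lemma aligned_neighbours:
  assumes L: "down_closed L" and T: "T \<in> SYT L"
    and cd: "c \<in> L" "d \<in> L" "T d = Suc (T c)" "fst c = fst d \<or> snd c = snd d"
  shows "odd (fst c + snd c) \<longleftrightarrow> even (fst d + snd d)"
proof -
  have row: "\<And>i j k. (i, j) \<in> L \<Longrightarrow> (i, k) \<in> L \<Longrightarrow> j < k \<Longrightarrow> T (i, j) < T (i, k)"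
    and col: "\<And>i j k. (i, k) \<in> L \<Longrightarrow> (j, k) \<in> L \<Longrightarrow> i < j \<Longrightarrow> T (i, k) < T (j, k)"
    using T by (auto simp: SYT_def)
  obtain i j i' j' where c: "c = (i, j)" and d: "d = (i', j')"
    by (cases c; cases d)
  consider "i = i'" | "j = j'"
    using cd c d by auto
  then show ?thesis
  proof cases
    case 1
    have "\<not> j' < j" "j' \<noteq> j"
      using row[of i j' j] cd c d 1 by auto
    moreover have "\<not> Suc j < j'"
    proof
      assume "Suc j < j'"
      moreover from this have "(i, Suc j) \<in> L"
        using down_closedD[OF L, of i j'] cd d 1 by simp
      ultimately show False
        using row[of i j "Suc j"] row[of i "Suc j" j'] cd c d 1 by simp
    qed
    ultimately have "j' = Suc j" by simp
    then show ?thesis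
      using c d 1 by simp
  next
    case 2
    have "\<not> i' < i" "i' \<noteq> i"
      using col[of i' j i] cd c d 2 by auto
    moreover have "\<not> Suc i < i'"
    proof
      assume "Suc i < i'"
      moreover from this have "(Suc i, j) \<in> L"
        using down_closedD[OF L, of i' j] cd d 2 by simp
      ultimately show False
        using col[of i j "Suc i"] col[of "Suc i" j i'] cd c d 2 by simp
    qed
    ultimately have "i' = Suc i" by simp
    then show ?thesis
      using c d 2 by simp
  qed
qed

text \<open>The interval splits into \<open>k\<close> pairs of consecutive numbers, each
  contributing one element. The offset \<open>s\<close> allows for an unpaired entry 1.\<close>

lemma card_alternating_pairs:
  fixes P :: "nat \<Rightarrow> bool"
  assumes "\<And>i. i < k \<Longrightarrow> P (s + 2 * i + 1) \<longleftrightarrow> \<not> P (s + 2 * i + 2)"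
  shows "card {x \<in> {s<..s + 2 * k}. P x} = k"
  using assms
proof (induction k)
  case (Suc k)
  let ?a = "s + 2 * k + 1" and ?b = "s + 2 * k + 2"
  have "{x \<in> {s<..s + 2 * Suc k}. P x} =
      insert (if P ?a then ?a else ?b) {x \<in> {s<..s + 2 * k}. P x}"
  proof (intro set_eqI)
    fix x
    have "x \<in> {s<..s + 2 * Suc k} \<longleftrightarrow> x \<in> {s<..s + 2 * k} \<or> x = ?a \<or> x = ?b"
      by auto
    then show "x \<in> {x \<in> {s<..s + 2 * Suc k}. P x} \<longleftrightarrow>
        x \<in> insert (if P ?a then ?a else ?b) {x \<in> {s<..s + 2 * k}. P x}"
      using Suc.prems[of k] by auto
  qed
  moreover have "card {x \<in> {s<..s + 2 * k}. P x} = k"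
    using Suc by simp
  ultimately show ?case
    by simp
qed simp

text \<open>Any other cell has a smaller entry at the top of its column or at the left end of its
  row.\<close>

lemma SYT_entry_1:
  assumes "down_closed L" "T \<in> SYT L" "c \<in> L" "T c = 1"
  shows "c = (0, 0)"
proof (rule ccontr)
  obtain i j where c: "c = (i, j)" by (cases c)
  have pos: "1 \<le> T d" if "d \<in> L" for d
    using assms(2) that by (auto simp: SYT_def bij_betw_def)
  have 0: "(0, j) \<in> L" "(i, 0) \<in> L"
    using down_closedD[OF assms(1), of i j] assms(3) c by auto
  assume "c \<noteq> (0, 0)"
  then consider "0 < i" | "0 < j"
    using c by auto
  then show False
  proof cases
    case 1
    then have "T (0, j) < T c"
      using assms(2,3) 0 c by (simp add: SYT_def)
    then show False using pos[OF 0(1)] assms(4) by simp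
  next
    case 2
    then have "T (i, 0) < T c"
      using assms(2,3) 0 c by (simp add: SYT_def)
    then show False using pos[OF 0(2)] assms(4) by simp
  qed
qed

lemma card_black_cells:
  assumes L: "finite L" "down_closed L" and imb: "imbalance L \<noteq> 0"
  shows "card {c \<in> L. odd (fst c + snd c)} = card L div 2"
proof -
  define n s k where "n = card L" and "s = n mod 2" and "k = n div 2"
  have n: "n = s + 2 * k"
    by (simp add: s_def k_def)
  obtain T where T: "T \<in> SYT L"
    and al: "\<And>m. 1 \<le> m \<Longrightarrow> m < n \<Longrightarrow> odd (n - m) \<Longrightarrow> aligned L T m"
    using imbalance_eq_0[OF L(1)] imb n_def by metis
  have bij: "bij_betw T L {1..n}"
    using T by (simp add: SYT_def n_def)
  \<comment> \<open>\<open>P x\<close> says that the entry \<open>x\<close> stands on a black cell;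
    counting black cells becomes counting entries.\<close>
  define P where "P x \<longleftrightarrow> (\<exists>c\<in>L. T c = x \<and> odd (fst c + snd c))" for x
  have P_T: "P (T c) \<longleftrightarrow> odd (fst c + snd c)" if "c \<in> L" for c
    using bij that by (auto simp: P_def bij_betw_def inj_on_def)
  have "P (s + 2 * i + 1) \<longleftrightarrow> \<not> P (s + 2 * i + 2)" if "i < k" for i
  proof -
    \<comment> \<open>The distance to \<open>n\<close> is odd, so this entry is the smaller member
      of a pair.\<close>
    have "n - (s + 2 * i + 1) = 2 * (k - i - 1) + 1"
      using n that by simp
    then have "aligned L T (s + 2 * i + 1)"
      using n that by (intro al) auto
    then obtain c d where "c \<in> L" "d \<in> L" "T c = s + 2 * i + 1" "T d = Suc (T c)"
      "fst c = fst d \<or> snd c = snd d"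
      by (auto simp: aligned_def)
    then show ?thesis
      using aligned_neighbours[OF L(2) T, of c d] P_T[of c] P_T[of d] by simp
  qed
  then have "card {x \<in> {s<..s + 2 * k}. P x} = k"
    by (rule card_alternating_pairs)
  moreover have "T ` {c \<in> L. odd (fst c + snd c)} = {x \<in> {s<..s + 2 * k}. P x}"
  proof -
    \<comment> \<open>If \<open>n\<close> is odd, the interval omits the entry 1. Nothing black is
      lost, since 1 occupies the white corner.\<close>
    have "x \<in> {s<..s + 2 * k}" if "P x" for x
    proof -
      obtain c where c: "c \<in> L" "T c = x" "odd (fst c + snd c)"
        using \<open>P x\<close> by (auto simp: P_def)
      then have "x \<in> {1..n}"
        using bij by (auto simp: bij_betw_def)
      moreover have "x \<noteq> 1"
        using SYT_entry_1[OF L(2) T c(1)] c by auto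
      moreover have "s \<le> 1"
        by (simp add: s_def)
      ultimately show ?thesis
        using n by simp
    qed
    then have "{x \<in> {s<..s + 2 * k}. P x} = {x. P x}"
      by auto
    then show ?thesis
      by (auto simp: P_def)
  qed
  moreover have "card (T ` {c \<in> L. odd (fst c + snd c)}) = card {c \<in> L. odd (fst c + snd c)}"
    using bij by (intro card_image) (auto simp: bij_betw_def inj_on_def)
  ultimately show ?thesis
    by (simp add: k_def n_def)
qed

section \<open>Cancellation between conjugate shapes\<close>

theorem theorem3p5:
  fixes n :: nat and F :: "cell set \<Rightarrow> complex"
  assumes "n mod 4 = 2 \<or> n mod 4 = 3"
    and "\<And>L. L \<in> shapes n \<Longrightarrow> F L = F (conjugate L)"
    and "\<And>L. L \<in> shapes n \<Longrightarrow> imbalance L = 0 \<Longrightarrow> F L = 0"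
  shows "(\<Sum>L\<in>shapes n. (-1) ^ vdom L * F L) = 0"
proof -
  let ?S = "\<Sum>L\<in>shapes n. (-1) ^ vdom L * F L"
  have "?S = (\<Sum>L\<in>shapes n. (-1) ^ vdom (conjugate L) * F (conjugate L))"
    by (rule sum.reindex_bij_betw[OF bij_betw_conjugate_shapes, symmetric])
  \<comment> \<open>Reindexing by conjugation negates every term, so the sum equals its own
    negative; self-conjugate shapes need no separate case.\<close>
  also have "\<dots> = (\<Sum>L\<in>shapes n. - ((-1) ^ vdom L * F L))"
  proof (rule sum.cong)
    fix L assume L: "L \<in> shapes n"
    show "(-1) ^ vdom (conjugate L) * F (conjugate L) = - ((-1) ^ vdom L * F L)"
    proof (cases "imbalance L = 0")
      case True
      then show ?thesis
        using assms(2,3)[OF L] by simp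
    next
      case False
      \<comment> \<open>The residue of \<open>n\<close> modulo 4 enters here: it makes the number of
        black cells odd.\<close>
      have "odd (n div 2)"
        using assms(1) by presburger
      moreover have *: "finite L" "down_closed L" "card L = n"
        using L by (simp_all add: shapes_iff)
      ultimately have "odd (vdom L + vdom (conjugate L))"
        using even_vdom_add_vdom_conjugate[OF *(1,2)] card_black_cells[OF *(1,2) False] by simp
      then have "(-1) ^ vdom (conjugate L) = - ((-1) ^ vdom L :: complex)"
        by (cases "even (vdom L)") auto
      then show ?thesis
        using assms(2)[OF L] by simp
    qed
  qed simp
  also have "\<dots> = - ?S"
    by (simp add: sum_negf)
  finally show ?thesis by simp
qed

end
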